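(* Let $\alpha\in(0,1)$, $t_0\in\mathbb{R}$ and let $P:\mathbb{R}\to\mathbb{R}$ be a polynomial function with real coefficients. Then $$D_{t_0,t}^\alpha\big[P(t)\big]^2\leq 2\Big[D_{t_0,t}^\alpha P(t)\Big]P(t),\quad\text{for every }t>t_0,$$ and $$cD_{t_0,t}^\alpha\big[P(t)\big]^2\leq 2\Big[cD_{t_0,t}^\alpha P(t)\Big]P(t),\quad\text{for every }t>t_0.$$
   Context: For $\alpha\in(0,1)$, the Riemann-Liouville fractional derivative of order $\alpha$ at $t_0$ is $$D_{t_0,t}^\alpha f(t)=\frac{d}{dt}\left\{\frac{1}{\Gamma(1-\alpha)}\int_{t_0}^t (t-s)^{-\alpha}f(s)\,ds\right\},$$ and the Caputo fractional derivative of order $\alpha$ at $t_0$ is $cD_{t_0,t}^\alpha f(t)=D_{t_0,t}^\alpha\big[f(t)-f(t_0)\big]$. The notation $D_{t_0,t}^\alpha[P(t)]^2$ means the fractional derivative of the function $t\mapsto P(t)^2$ (and similarly for $cD$). For polynomials these derivatives exist at every $t>t_0$: for $k\in\mathbb{N}$, $D_{t_0,t}^\alpha (t-t_0)^k=\frac{\Gamma(k+1)}{\Gamma(k+1-\alpha)}(t-t_0)^{k-\alpha}$, and $cD_{t_0,t}^\alpha(t-t_0)^k$ is the same for $k>0$ and equals $0$ for $k=0$. *)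

theory Defs
  imports "HOL-Analysis.Analysis"
begin

(* The kernel takes the value 0 powr (-\<alpha>) = 0 at the singular endpoint s = t,
   which is a null set.  For t < t0 the interval is empty; the operators are only meant
   to be evaluated at t > t0, where the derivative is two-sided. *)

definition RL_deriv :: "real \<Rightarrow> real \<Rightarrow> (real \<Rightarrow> real) \<Rightarrow> real \<Rightarrow> real" where
  "RL_deriv \<alpha> t0 f t =
     deriv (\<lambda>u. 1 / Gamma (1 - \<alpha>) *
                (LINT s:{t0..u}|lebesgue. (u - s) powr (- \<alpha>) * f s)) t"

definition Caputo_deriv :: "real \<Rightarrow> real \<Rightarrow> (real \<Rightarrow> real) \<Rightarrow> real \<Rightarrow> real" where
  "Caputo_deriv \<alpha> t0 f t = RL_deriv \<alpha> t0 (\<lambda>s. f s - f t0) t"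

end

theory Submission
  imports Defs "HOL-Computational_Algebra.Polynomial"
begin

text \<open>
  Rescaling \<open>[t0, u]\<close> to the unit interval turns the fractional integral of a polynomial into
  \<open>(u - t0) powr (1 - \<alpha>)\<close> times the integral of \<open>(1 - v) powr (- \<alpha>) * f (t0 + (u - t0) * v)\<close>,
  which can be differentiated in \<open>u\<close>. With \<open>p v = P (t0 + (t - t0) * v)\<close>, the derivative at
  \<open>t\<close> is a positive multiple of the linear functional \<open>L p\<close>, the integral of
  \<open>(1 - v) powr (- \<alpha>) * ((1 - \<alpha>) * p v + v * p' v)\<close>. As
  \<open>p\<^sup>2 - 2 * p 1 * p = (p - p 1)\<^sup>2 - (p 1)\<^sup>2\<close> and \<open>L 1 \<ge> 0\<close>, it remains to see
  \<open>L g \<le> 0\<close> for \<open>g = (p - p 1)\<^sup>2\<close>: the integrand is at most the derivative of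
  \<open>v * (1 - v) powr (- \<alpha>) * g v\<close>, which vanishes at both endpoints because \<open>g\<close> has a double
  zero at \<open>1\<close>.
  The Caputo case is the Riemann-Liouville case for \<open>P - P t0\<close>.
\<close>

lemma real_polynomial_function_imp_poly:
  assumes "real_polynomial_function f"
  obtains p where "f = poly p"
proof -
  obtain a n where "f = (\<lambda>x. \<Sum>i\<le>n. a i * x ^ i)"
    using assms by (auto simp: real_polynomial_function_iff_sum)
  then have "f = poly (\<Sum>i\<le>n. monom (a i) i)"
    by (auto simp: poly_sum poly_monom)
  then show thesis by (rule that)
qed

section \<open>Weighted integrals of polynomials on the unit interval\<close>

definition kernel_integral :: "real \<Rightarrow> real poly \<Rightarrow> real" where
  "kernel_integral \<alpha> p = (LINT v:{0..1}|lebesgue. (1 - v) powr (- \<alpha>) * poly p v)"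

text \<open>The product rule at \<open>x = 1\<close>, applied to
  \<open>x powr (1 - \<alpha>)\<close> times the kernel integral of the polynomial p(x v) in v,
  gives this expression. For \<open>\<alpha> < 1\<close> it is \<open>Gamma (1 - \<alpha>)\<close>
  times the Riemann-Liouville derivative of \<open>p\<close> at 1 with base point 0.\<close>

definition unit_RL :: "real \<Rightarrow> real poly \<Rightarrow> real" where
  "unit_RL \<alpha> p = kernel_integral \<alpha> (smult (1 - \<alpha>) p + pCons 0 (pderiv p))"

text \<open>The antiderivative has the positive exponent \<open>1 - \<alpha>\<close>, so it stays
  continuous at the singular endpoint; nonnegativity of the kernel turns integrability into absolute
  integrability.\<close>

lemma kernel_absolutely_integrable:
  assumes "\<alpha> < 1"
  shows "(\<lambda>v::real. (1 - v) powr (- \<alpha>)) absolutely_integrable_on {0..1}"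
proof (rule nonnegative_absolutely_integrable_1)
  have "((\<lambda>v. (1 - v) powr (- \<alpha>)) has_integral
      (- ((1 - 1) powr (1 - \<alpha>)) / (1 - \<alpha>)) - (- ((1 - 0) powr (1 - \<alpha>)) / (1 - \<alpha>))) {0..1::real}"
  proof (rule fundamental_theorem_of_calculus_interior)
    show "continuous_on {0..1} (\<lambda>v::real. - ((1 - v) powr (1 - \<alpha>)) / (1 - \<alpha>))"
      using assms by (intro continuous_intros continuous_on_powr') auto
    show "((\<lambda>v. - ((1 - v) powr (1 - \<alpha>)) / (1 - \<alpha>)) has_vector_derivative
        (1 - v) powr (- \<alpha>)) (at v)" if "v \<in> {0<..<1}" for v :: real
    proof -
      have "((\<lambda>v. - ((1 - v) powr (1 - \<alpha>))) has_real_derivative (1 - v) powr (- \<alpha>) * (1 - \<alpha>)) (at v)"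
        using that by (auto intro!: derivative_eq_intros)
      from DERIV_cdivide[OF this, of "1 - \<alpha>"] show ?thesis
        using assms by (simp add: has_real_derivative_iff_has_vector_derivative)
    qed
  qed simp
  then show "(\<lambda>v::real. (1 - v) powr (- \<alpha>)) integrable_on {0..1}"
    by (rule has_integral_integrable)
qed simp

lemma kernel_poly_absolutely_integrable:
  fixes p :: "real poly"
  assumes "\<alpha> < 1"
  shows "(\<lambda>v. (1 - v) powr (- \<alpha>) * poly p v) absolutely_integrable_on {0..1}"
proof -
  have "(\<lambda>v. poly p v * (1 - v) powr (- \<alpha>)) absolutely_integrable_on {0..1}"
  proof (rule absolutely_integrable_bounded_measurable_product_real)
    show "poly p \<in> borel_measurable (lebesgue_on {0..1})"
      by (intro continuous_imp_measurable_on_sets_lebesgue continuous_intros) auto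
    show "bounded (poly p ` {0..1})"
      by (intro compact_imp_bounded compact_continuous_image continuous_intros) auto
  qed (use kernel_absolutely_integrable[OF assms] in auto)
  then show ?thesis by (simp add: mult.commute)
qed

lemma kernel_integral_add:
  assumes "\<alpha> < 1"
  shows "kernel_integral \<alpha> (p + q) = kernel_integral \<alpha> p + kernel_integral \<alpha> q"
  unfolding kernel_integral_def
  by (simp add: distrib_left set_integral_add kernel_poly_absolutely_integrable[OF assms])

lemma kernel_integral_smult:
  "kernel_integral \<alpha> (smult c p) = c * kernel_integral \<alpha> p"
  unfolding kernel_integral_def
  by (simp add: mult.left_commute[of _ c])

lemma unit_RL_add:
  assumes "\<alpha> < 1"
  shows "unit_RL \<alpha> (p + q) = unit_RL \<alpha> p + unit_RL \<alpha> q"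
proof -
  have "smult (1 - \<alpha>) (p + q) + pCons 0 (pderiv (p + q)) =
      (smult (1 - \<alpha>) p + pCons 0 (pderiv p)) + (smult (1 - \<alpha>) q + pCons 0 (pderiv q))"
    by (simp add: pderiv_add smult_add_right)
  then show ?thesis
    unfolding unit_RL_def using kernel_integral_add[OF assms] by metis
qed

lemma unit_RL_smult: "unit_RL \<alpha> (smult c p) = c * unit_RL \<alpha> p"
proof -
  have "smult (1 - \<alpha>) (smult c p) + pCons 0 (pderiv (smult c p)) =
      smult c (smult (1 - \<alpha>) p + pCons 0 (pderiv p))"
    by (simp add: pderiv_smult smult_add_right mult.commute)
  then show ?thesis
    unfolding unit_RL_def using kernel_integral_smult by metis
qed

section \<open>The square inequality on the unit interval\<close>

lemma unit_RL_one_nonneg: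
  assumes "\<alpha> < 1"
  shows "unit_RL \<alpha> 1 \<ge> 0"
proof -
  have "kernel_integral \<alpha> 1 \<ge> 0"
    unfolding kernel_integral_def set_lebesgue_integral_def
    by (intro Bochner_Integration.integral_nonneg) auto
  moreover have "unit_RL \<alpha> 1 = (1 - \<alpha>) * kernel_integral \<alpha> 1"
    unfolding unit_RL_def kernel_integral_smult[symmetric] by simp
  ultimately show ?thesis
    using assms by simp
qed

lemma unit_RL_double_zero_nonpos:
  fixes r :: "real poly"
  assumes "0 < \<alpha>" and "\<alpha> < 1"
  shows "unit_RL \<alpha> (([:-1, 1:] * r)\<^sup>2) \<le> 0"
proof -
  define g where "g = ([:-1, 1:] * r)\<^sup>2"
  have poly_g: "poly g v = (1 - v)\<^sup>2 * (poly r v)\<^sup>2" for v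
    by (simp add: g_def power2_eq_square algebra_simps)
  \<comment> \<open>Absorbing the double zero of \<open>g\<close> leaves the positive exponent
    \<open>2 - \<alpha>\<close>, so \<open>W\<close> is continuous up to 1 and vanishes there. Below
    1 it is differentiated in the form given by \<open>W_eq\<close>.\<close>
  define W where "W = (\<lambda>v. v * ((1 - v) powr (2 - \<alpha>) * (poly r v)\<^sup>2))"
  define W' where "W' = (\<lambda>v. (1 - v) powr (- \<alpha>) * (poly g v + v * poly (pderiv g) v)
      + \<alpha> * v * (1 - v) powr (- \<alpha> - 1) * poly g v)"
  define h where "h = (\<lambda>v. (1 - v) powr (- \<alpha>) * poly (smult (1 - \<alpha>) g + pCons 0 (pderiv g)) v)"
  have W_eq: "W v = v * (1 - v) powr (- \<alpha>) * poly g v" if "v < 1" for v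
  proof -
    have "(1 - v) powr (2 - \<alpha>) = (1 - v) powr (- \<alpha>) * (1 - v)\<^sup>2"
      using that powr_add[of "1 - v" "- \<alpha>" 2] by (simp add: powr_numeral)
    then show ?thesis by (simp add: W_def poly_g)
  qed
  have "(W' has_integral (W 1 - W 0)) {0..1}"
  proof (rule fundamental_theorem_of_calculus_interior)
    show "continuous_on {0..1} W"
      unfolding W_def using assms by (intro continuous_intros continuous_on_powr') auto
    show "(W has_vector_derivative W' v) (at v)" if "v \<in> {0<..<1}" for v
    proof -
      have "((\<lambda>v. v * (1 - v) powr (- \<alpha>) * poly g v) has_real_derivative W' v) (at v)"
        unfolding W'_def using that
        by (auto intro!: derivative_eq_intros simp: algebra_simps)
      then have "(W has_real_derivative W' v) (at v)"
        by (rule has_field_derivative_transform_within_open[where S = "{..<1}"])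
           (use that W_eq in auto)
      then show ?thesis
        by (simp add: has_real_derivative_iff_has_vector_derivative)
    qed
  qed simp
  then have W': "(W' has_integral 0) {0..1}"
    by (simp add: W_def)
  have h_int: "h absolutely_integrable_on {0..1}"
    unfolding h_def by (rule kernel_poly_absolutely_integrable[OF assms(2)])
  then have "(h has_integral integral {0..1} h) {0..1}"
    by (intro integrable_integral set_lebesgue_integral_eq_integral)
  moreover have "h v \<le> W' v" if "v \<in> {0..1}" for v
  proof -
    \<comment> \<open>The first term arises because \<open>h\<close> has the coefficient
      \<open>1 - \<alpha>\<close> where \<open>W'\<close> has 1, the second from differentiating the
      kernel; both are nonnegative since \<open>g\<close> is a square.\<close>
    have "W' v - h v = \<alpha> * (1 - v) powr (- \<alpha>) * poly g v
        + \<alpha> * v * (1 - v) powr (- \<alpha> - 1) * poly g v"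
      by (simp add: W'_def h_def algebra_simps)
    also have "\<dots> \<ge> 0"
      using that assms by (simp add: poly_g)
    finally show ?thesis by simp
  qed
  ultimately have "integral {0..1} h \<le> 0"
    using W' has_integral_le by blast
  then show ?thesis
    using set_lebesgue_integral_eq_integral(2)[OF h_int]
    by (simp add: unit_RL_def kernel_integral_def h_def g_def)
qed

lemma unit_RL_square_le:
  assumes "0 < \<alpha>" and "\<alpha> < 1"
  shows "unit_RL \<alpha> (p\<^sup>2) \<le> 2 * poly p 1 * unit_RL \<alpha> p"
proof -
  define c where "c = poly p 1"
  have "poly (p - [:c:]) 1 = 0" by (simp add: c_def)
  then obtain r where r: "p - [:c:] = [:-1, 1:] * r"
    unfolding poly_eq_0_iff_dvd by (auto elim: dvdE)
  have "p\<^sup>2 = (p - [:c:])\<^sup>2 + smult (2 * c) p + smult (- c\<^sup>2) 1"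
    unfolding poly_eq_poly_eq_iff[symmetric]
    by (simp add: fun_eq_iff power2_eq_square algebra_simps)
  then have "unit_RL \<alpha> (p\<^sup>2) = unit_RL \<alpha> (([:-1, 1:] * r)\<^sup>2) + 2 * c * unit_RL \<alpha> p - c\<^sup>2 * unit_RL \<alpha> 1"
    unfolding r by (simp only: unit_RL_add[OF assms(2)] unit_RL_smult)
  moreover have "c\<^sup>2 * unit_RL \<alpha> 1 \<ge> 0"
    using unit_RL_one_nonneg[OF assms(2)] by simp
  ultimately show ?thesis
    using unit_RL_double_zero_nonpos[OF assms, of r] by (simp add: c_def)
qed

section \<open>Differentiating the rescaled fractional integral\<close>

text \<open>The factor \<open>r\<close> keeps the induction on \<open>p\<close> going: the step moves a factor \<open>v\<close> into it.\<close>

lemma kernel_integral_pcompose_has_derivative: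
  assumes "\<alpha> < 1"
  shows "((\<lambda>c. kernel_integral \<alpha> (r * pcompose p [:0, c:])) has_real_derivative
    kernel_integral \<alpha> (r * pCons 0 (pcompose (pderiv p) [:0, c:]))) (at c)"
proof (induction p arbitrary: r)
  case 0
  then show ?case by (simp add: pcompose_0 kernel_integral_def)
next
  case (pCons a p)
  \<comment> \<open>Horner's scheme: the dependence on \<open>x\<close> is a constant plus
    \<open>x\<close> times an instance of the induction hypothesis with \<open>pCons 0 r\<close> for
    \<open>r\<close>. The product rule then replaces any interchange of derivative and
    integral.\<close>
  have eq: "r * pcompose (pCons a p) [:0, x:] =
      smult a r + smult x (pCons 0 r * pcompose p [:0, x:])" for x
    by (simp add: pcompose_pCons algebra_simps)
  have eq': "r * pCons 0 (pcompose (pderiv (pCons a p)) [:0, c:]) =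
      pCons 0 r * pcompose p [:0, c:] + smult c (pCons 0 r * pCons 0 (pcompose (pderiv p) [:0, c:]))"
    by (simp add: pderiv_pCons pcompose_add pcompose_pCons algebra_simps)
  show ?case
    unfolding eq eq' kernel_integral_add[OF assms] kernel_integral_smult
    by (rule DERIV_cong[OF DERIV_add[OF DERIV_const DERIV_mult[OF DERIV_ident pCons.IH]]]) simp
qed

text \<open>Substituting \<open>s = t0 + (u - t0) * v\<close> frees the interval and the singular
  kernel of \<open>u\<close>. The translation by \<open>t0\<close> is kept apart from the scaling
  because only the scaling factor is differentiated later.\<close>

lemma RL_integral_rescale:
  assumes "t0 < u"
  shows "(LINT s:{t0..u}|lebesgue. (u - s) powr (- \<alpha>) * poly p s) =
    (u - t0) powr (1 - \<alpha>) * kernel_integral \<alpha> (pcompose (pcompose p [:t0, 1:]) [:0, u - t0:])"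
proof -
  define c where "c = u - t0"
  have c: "c > 0" using assms by (simp add: c_def)
  let ?f = "\<lambda>s. indicator {t0..u} s *\<^sub>R ((u - s) powr (- \<alpha>) * poly p s)"
  let ?g = "\<lambda>v. indicator {0..1} v *\<^sub>R ((1 - v) powr (- \<alpha>) * poly p (t0 + c * v))"
  have [measurable]: "poly p \<in> borel_measurable borel"
    by (intro borel_measurable_continuous_onI continuous_intros)
  have f_g: "?f (t0 + c * v) = c powr (- \<alpha>) * ?g v" for v
  proof (cases "v \<in> {0..1}")
    case True
    then have "0 \<le> c * v" "c * v \<le> c"
      using c by (auto simp: mult_left_le)
    then have "u - (t0 + c * v) = c * (1 - v)" "t0 + c * v \<in> {t0..u}"
      by (auto simp: c_def algebra_simps)
    then show ?thesis
      using True c by (simp add: powr_mult)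
  next
    case False
    then have "c * v < 0 \<or> c < c * v"
      using c by (auto simp: mult_less_0_iff)
    then have "t0 + c * v \<notin> {t0..u}"
      by (auto simp: c_def)
    then show ?thesis using False by simp
  qed
  \<comment> \<open>The integrands are Borel measurable, so the affine substitution can be made in
    \<open>lborel\<close> without changing the integrals.\<close>
  have "(LINT s:{t0..u}|lebesgue. (u - s) powr (- \<alpha>) * poly p s) = (LINT s|lborel. ?f s)"
    unfolding set_lebesgue_integral_def by (rule integral_completion) measurable
  also have "\<dots> = c * (LINT v|lborel. ?f (t0 + c * v))"
    using c by (subst lborel_integral_real_affine[where c = c and t = t0]) auto
  also have "\<dots> = c * c powr (- \<alpha>) * (LINT v|lborel. ?g v)"
    unfolding f_g by simp
  also have "(LINT v|lborel. ?g v) = (LINT v|lebesgue. ?g v)"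
    by (rule integral_completion[symmetric]) measurable
  also have "c * c powr (- \<alpha>) = c powr (1 - \<alpha>)"
    using c by (simp add: powr_diff powr_minus field_simps)
  finally show ?thesis
    by (simp add: kernel_integral_def set_lebesgue_integral_def poly_pcompose c_def mult.commute)
qed

text \<open>After rescaling, the product rule in \<open>x = u - t0\<close> applies; pulling out
  \<open>c powr (- \<alpha>)\<close> leaves the two summands of \<open>unit_RL\<close>.\<close>

lemma RL_deriv_poly:
  assumes "\<alpha> < 1" and "t0 < t"
  shows "RL_deriv \<alpha> t0 (poly p) t =
    (t - t0) powr (- \<alpha>) / Gamma (1 - \<alpha>) * unit_RL \<alpha> (pcompose p [:t0, t - t0:])"
proof -
  define q where "q = pcompose p [:t0, 1:]"
  define c where "c = t - t0"
  have c: "c > 0" using assms by (simp add: c_def)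
  let ?J = "\<lambda>x. kernel_integral \<alpha> (pcompose q [:0, x:])"
  let ?J' = "kernel_integral \<alpha> (pCons 0 (pcompose (pderiv q) [:0, c:]))"
  have q_c: "pcompose q [:0, c:] = pcompose p [:t0, c:]"
    by (simp add: q_def pcompose_assoc[symmetric] pcompose_pCons)
  have J: "(?J has_real_derivative ?J') (at c)"
    using kernel_integral_pcompose_has_derivative[OF assms(1), of 1] by simp
  have "((\<lambda>x. 1 / Gamma (1 - \<alpha>) * (x powr (1 - \<alpha>) * ?J x)) has_real_derivative
      1 / Gamma (1 - \<alpha>) * ((1 - \<alpha>) * c powr (- \<alpha>) * ?J c + ?J' * c powr (1 - \<alpha>))) (at c)"
    using c by (intro DERIV_cmult) (auto intro!: derivative_eq_intros J)
  then have "((\<lambda>u. 1 / Gamma (1 - \<alpha>) * ((u - t0) powr (1 - \<alpha>) * ?J (u - t0))) has_real_derivative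
      1 / Gamma (1 - \<alpha>) * ((1 - \<alpha>) * c powr (- \<alpha>) * ?J c + ?J' * c powr (1 - \<alpha>))) (at t)"
    using DERIV_shift[of _ _ t "- t0"] by (simp add: c_def)
  then have "((\<lambda>u. 1 / Gamma (1 - \<alpha>) * (LINT s:{t0..u}|lebesgue. (u - s) powr (- \<alpha>) * poly p s))
      has_real_derivative
      1 / Gamma (1 - \<alpha>) * ((1 - \<alpha>) * c powr (- \<alpha>) * ?J c + ?J' * c powr (1 - \<alpha>))) (at t)"
    \<comment> \<open>The rescaled formula holds on an open neighbourhood of \<open>t\<close>, which
      suffices for the two-sided derivative.\<close>
    by (rule has_field_derivative_transform_within_open[where S = "{t0<..}"])
       (use assms in \<open>auto simp: RL_integral_rescale q_def\<close>)
  then have "RL_deriv \<alpha> t0 (poly p) t =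
      1 / Gamma (1 - \<alpha>) * ((1 - \<alpha>) * c powr (- \<alpha>) * ?J c + ?J' * c powr (1 - \<alpha>))"
    unfolding RL_deriv_def by (rule DERIV_imp_deriv)
  also have "c powr (1 - \<alpha>) = c powr (- \<alpha>) * c"
    using c by (simp add: powr_diff powr_minus field_simps)
  also have "1 / Gamma (1 - \<alpha>) * ((1 - \<alpha>) * c powr (- \<alpha>) * ?J c + ?J' * (c powr (- \<alpha>) * c)) =
      c powr (- \<alpha>) / Gamma (1 - \<alpha>) * ((1 - \<alpha>) * ?J c + c * ?J')"
    by (simp add: algebra_simps add_divide_distrib diff_divide_distrib)
  also have "(1 - \<alpha>) * ?J c + c * ?J' = unit_RL \<alpha> (pcompose q [:0, c:])"
  proof -
    \<comment> \<open>By the chain rule the inner derivative supplies the factor \<open>c\<close> in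
      front of \<open>?J'\<close>.\<close>
    have "pCons 0 (pderiv (pcompose q [:0, c:])) = smult c (pCons 0 (pcompose (pderiv q) [:0, c:]))"
      by (simp add: pderiv_pcompose pderiv_pCons mult.commute)
    then show ?thesis
      by (simp only: unit_RL_def kernel_integral_add[OF assms(1)] kernel_integral_smult)
  qed
  finally show ?thesis by (simp only: q_c) (simp only: c_def)
qed

section \<open>Linearity and the two inequalities\<close>

lemma RL_deriv_poly_add:
  assumes "\<alpha> < 1" and "t0 < t"
  shows "RL_deriv \<alpha> t0 (poly (p + q)) t = RL_deriv \<alpha> t0 (poly p) t + RL_deriv \<alpha> t0 (poly q) t"
  unfolding RL_deriv_poly[OF assms] pcompose_add unit_RL_add[OF assms(1)] by (rule distrib_left)

lemma RL_deriv_poly_smult: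
  assumes "\<alpha> < 1" and "t0 < t"
  shows "RL_deriv \<alpha> t0 (poly (smult a p)) t = a * RL_deriv \<alpha> t0 (poly p) t"
  unfolding RL_deriv_poly[OF assms] pcompose_smult unit_RL_smult by simp

lemma RL_deriv_poly_square_le:
  assumes "0 < \<alpha>" and "\<alpha> < 1" and "t0 < t"
  shows "RL_deriv \<alpha> t0 (poly (p\<^sup>2)) t \<le> 2 * RL_deriv \<alpha> t0 (poly p) t * poly p t"
proof -
  let ?q = "pcompose p [:t0, t - t0:]"
  let ?k = "(t - t0) powr (- \<alpha>) / Gamma (1 - \<alpha>)"
  have "?k \<ge> 0"
    using assms by (simp add: Gamma_real_pos less_imp_le)
  then have "?k * unit_RL \<alpha> (?q\<^sup>2) \<le> ?k * (2 * poly ?q 1 * unit_RL \<alpha> ?q)"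
    by (intro mult_left_mono unit_RL_square_le assms)
  moreover have "poly ?q 1 = poly p t" by (simp add: poly_pcompose)
  ultimately show ?thesis
    by (simp add: RL_deriv_poly[OF assms(2,3)] power2_eq_square pcompose_mult ac_simps)
qed

theorem theorem13:
  fixes \<alpha> t0 :: real and P :: "real \<Rightarrow> real"
  assumes "0 < \<alpha>" and "\<alpha> < 1"
    and "real_polynomial_function P"
  shows "(\<forall>t>t0. RL_deriv \<alpha> t0 (\<lambda>s. (P s)\<^sup>2) t \<le> 2 * RL_deriv \<alpha> t0 P t * P t) \<and>
         (\<forall>t>t0. Caputo_deriv \<alpha> t0 (\<lambda>s. (P s)\<^sup>2) t \<le> 2 * Caputo_deriv \<alpha> t0 P t * P t)"
proof (intro conjI allI impI)
  obtain p where P: "P = poly p"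
    using assms(3) by (rule real_polynomial_function_imp_poly)
  fix t assume t: "t0 < t"
  have "(\<lambda>s. (P s)\<^sup>2) = poly (p\<^sup>2)"
    by (simp add: P fun_eq_iff)
  then show "RL_deriv \<alpha> t0 (\<lambda>s. (P s)\<^sup>2) t \<le> 2 * RL_deriv \<alpha> t0 P t * P t"
    using RL_deriv_poly_square_le[OF assms(1,2) t] by (simp add: P)
  define q where "q = p - [:P t0:]"
  have q: "(\<lambda>s. P s - P t0) = poly q"
    by (simp add: P q_def fun_eq_iff)
  \<comment> \<open>Since \<open>P = q + P t0\<close>, the square exceeds its initial value by the
    square of \<open>q\<close> plus a linear term. That linear term later turns the factor
    \<open>poly q t\<close> of the Riemann-Liouville bound into \<open>P t\<close>.\<close>
  have "(\<lambda>s. (P s)\<^sup>2 - (P t0)\<^sup>2) = poly (q\<^sup>2 + smult (2 * P t0) q)"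
    by (simp add: P q_def fun_eq_iff power2_eq_square algebra_simps)
  then have "Caputo_deriv \<alpha> t0 (\<lambda>s. (P s)\<^sup>2) t =
      RL_deriv \<alpha> t0 (poly (q\<^sup>2)) t + 2 * P t0 * RL_deriv \<alpha> t0 (poly q) t"
    by (simp only: Caputo_deriv_def RL_deriv_poly_add[OF assms(2) t] RL_deriv_poly_smult[OF assms(2) t])
  also have "\<dots> \<le> 2 * RL_deriv \<alpha> t0 (poly q) t * poly q t + 2 * P t0 * RL_deriv \<alpha> t0 (poly q) t"
    using RL_deriv_poly_square_le[OF assms(1,2) t, of q] by simp
  also have "\<dots> = 2 * Caputo_deriv \<alpha> t0 P t * P t"
    unfolding Caputo_deriv_def q by (simp add: q_def P algebra_simps)
  finally show "Caputo_deriv \<alpha> t0 (\<lambda>s. (P s)\<^sup>2) t \<le> 2 * Caputo_deriv \<alpha> t0 P t * P t" .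
qed

end
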